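(* There is a positive absolute constant $\alpha$ such that the following holds. For any integers $k$ and $\ell$ with $2 \leq \ell < k$ and every sufficiently large integer $n$, \[ \max \left\{ 1 - \frac{\ell}{k},\; 1- \frac{4 \binom{\ell+2}{3}}{k(k+2)}\right\} \;\leq\; \mathbf{d}(Q_n, Q_\ell, Q_k) \;\leq\; \min \left\{ 1-\frac{\ell\, 2^{\ell}}{k\,2^k},\; 1- \alpha \frac{\log k}{k\,2^k}\right\}. \]
   Context: $Q_n$ denotes the $n$-dimensional hypercube: its vertices are the binary vectors of length $n$, two vectors being adjacent iff they differ in exactly one coordinate. For graphs $G$ and $T$, a copy of $T$ in $G$ is a subgraph of $G$ isomorphic to $T$, and $N(G,T)$ is the number of copies of $T$ in $G$. A graph is $H$-free if it has no subgraph isomorphic to $H$. For subgraphs $T,H$ of $G$, $\mathrm{ex}(G,T,H)=\max\{N(G',T): G'\subseteq G,\ G' \text{ is } H\text{-free}\}$ and $\mathbf{d}(G,T,H)=\mathrm{ex}(G,T,H)/N(G,T)$. *)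

theory Defs
  imports Complex_Main
begin

text \<open>Simple graphs are pairs of a vertex set and a set of edges, an edge being a set of two
  vertices.\<close>

type_synonym 'a ugraph = "'a set \<times> 'a set set"

abbreviation verts :: "'a ugraph \<Rightarrow> 'a set" where "verts G \<equiv> fst G"

abbreviation edges :: "'a ugraph \<Rightarrow> 'a set set" where "edges G \<equiv> snd G"

definition is_ugraph :: "'a ugraph \<Rightarrow> bool" where
  "is_ugraph G \<longleftrightarrow> (\<forall>e\<in>edges G. e \<subseteq> verts G \<and> card e = 2)"

text \<open>Subgraphs need be neither induced nor spanning.\<close>

definition is_subgraph :: "'a ugraph \<Rightarrow> 'a ugraph \<Rightarrow> bool" where
  "is_subgraph S G \<longleftrightarrow>
     is_ugraph S \<and> is_ugraph G \<and> verts S \<subseteq> verts G \<and> edges S \<subseteq> edges G"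

definition graph_iso :: "'a ugraph \<Rightarrow> 'b ugraph \<Rightarrow> bool" where
  "graph_iso G H \<longleftrightarrow>
     (\<exists>f. bij_betw f (verts G) (verts H) \<and>
        (\<forall>u\<in>verts G. \<forall>v\<in>verts G. {u, v} \<in> edges G \<longleftrightarrow> {f u, f v} \<in> edges H))"

definition copies :: "'a ugraph \<Rightarrow> 'b ugraph \<Rightarrow> 'a ugraph set" where
  "copies G T = {S. is_subgraph S G \<and> graph_iso S T}"

definition num_copies :: "'a ugraph \<Rightarrow> 'b ugraph \<Rightarrow> nat" where
  "num_copies G T = card (copies G T)"

definition graph_free :: "'a ugraph \<Rightarrow> 'b ugraph \<Rightarrow> bool" where
  "graph_free G H \<longleftrightarrow> \<not> (\<exists>S. is_subgraph S G \<and> graph_iso S H)"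

text \<open>\<open>Max\<close> is meaningful when \<open>G\<close> is finite and some subgraph of \<open>G\<close> is \<open>H\<close>-free; see
  \<open>ex_num_attained\<close> and \<open>ex_num_upper\<close> below.\<close>

definition ex_num :: "'a ugraph \<Rightarrow> 'b ugraph \<Rightarrow> 'c ugraph \<Rightarrow> nat" where
  "ex_num G T H = Max {num_copies G' T | G'. is_subgraph G' G \<and> graph_free G' H}"

definition ex_density :: "'a ugraph \<Rightarrow> 'b ugraph \<Rightarrow> 'c ugraph \<Rightarrow> real" where
  "ex_density G T H = real (ex_num G T H) / real (num_copies G T)"

definition hypercube :: "nat \<Rightarrow> bool list ugraph" where
  "hypercube n =
     ({u. length u = n},
      {{u, v} | u v. length u = n \<and> length v = n \<and> card {i. i < n \<and> u ! i \<noteq> v ! i} = 1})"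

lemma is_ugraph_hypercube: "is_ugraph (hypercube n)"
proof -
  have "card {u, v} = 2" if "card {i. i < n \<and> u ! i \<noteq> v ! i} = 1" for u v :: "bool list"
    using that by (cases "u = v") auto
  then show ?thesis
    by (auto simp: is_ugraph_def hypercube_def)
qed

lemma finite_verts_hypercube: "finite (verts (hypercube n))"
  using finite_lists_length_eq[of "UNIV :: bool set" n] by (simp add: hypercube_def)

lemma finite_subgraphs:
  assumes "finite (verts G)"
  shows "finite {S. is_subgraph S G}"
proof (rule finite_subset)
  show "{S. is_subgraph S G} \<subseteq> Pow (verts G) \<times> Pow (Pow (verts G))"
    by (force simp: is_subgraph_def is_ugraph_def)
  show "finite (Pow (verts G) \<times> Pow (Pow (verts G)))"
    using assms by simp
qed

lemma ex_num_candidates: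
  assumes "is_ugraph G" "finite (verts G)" "verts H \<noteq> {}"
  shows "finite {num_copies G' T | G'. is_subgraph G' G \<and> graph_free G' H}"
    and "{num_copies G' T | G'. is_subgraph G' G \<and> graph_free G' H} \<noteq> {}"
proof -
  have "{num_copies G' T | G'. is_subgraph G' G \<and> graph_free G' H}
      \<subseteq> (\<lambda>G'. num_copies G' T) ` {S. is_subgraph S G}"
    by auto
  then show "finite {num_copies G' T | G'. is_subgraph G' G \<and> graph_free G' H}"
    using finite_subgraphs[OF assms(2)] finite_surj by blast
  have "is_subgraph ({}, {}) G"
    using assms(1) by (simp add: is_subgraph_def is_ugraph_def)
  moreover have "graph_free ({} :: 'a set, {}) H"
    using assms(3) by (auto simp: graph_free_def is_subgraph_def graph_iso_def bij_betw_def)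
  ultimately show "{num_copies G' T | G'. is_subgraph G' G \<and> graph_free G' H} \<noteq> {}"
    by blast
qed

lemma ex_num_attained:
  assumes "is_ugraph G" "finite (verts G)" "verts H \<noteq> {}"
  obtains G' where "is_subgraph G' G" "graph_free G' H" "ex_num G T H = num_copies G' T"
  using Max_in[OF ex_num_candidates[OF assms]] unfolding ex_num_def by blast

lemma ex_num_upper:
  assumes "is_ugraph G" "finite (verts G)" "verts H \<noteq> {}"
    and "is_subgraph G' G" "graph_free G' H"
  shows "num_copies G' T \<le> ex_num G T H"
  unfolding ex_num_def
proof (rule Max_ge[OF ex_num_candidates(1)[OF assms(1-3)]])
  show "num_copies G' T \<in> {num_copies G' T | G'. is_subgraph G' G \<and> graph_free G' H}"
    using assms(4,5) by blast
qed

end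

theory Submission
  imports Defs
begin

text \<open>
  Every copy of \<open>Q\<^sub>l\<close> in \<open>Q\<^sub>n\<close> is a subcube, so the density concerns sets of missing edges that
  meet every \<open>k\<close>-dimensional subcube, and the \<open>l\<close>-dimensional subcubes that avoid them.

  Lower bounds: colour the edges of \<open>Q\<^sub>n\<close> so that every \<open>Q\<^sub>k\<close> sees all colours; deleting a colour
  class destroys all copies of \<open>Q\<^sub>k\<close>, and for the best class it destroys at most the average number of
  copies of \<open>Q\<^sub>l\<close>. Colouring by the level modulo \<open>k\<close> gives the first bound. The second comes from the
  colouring of Alon, Krech and Szabo by two residues, with \<open>\<lfloor>(k+1)\<^sup>2/4\<rfloor>\<close> colours, of which a \<open>Q\<^sub>l\<close> sees at
  most \<open>\<Sum>p<l. (p + 1) * (l - p) = (l + 2) choose 3\<close>.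

  Upper bounds: a missing edge of a \<open>Q\<^sub>k\<close> spoils a fraction \<open>l 2\<^sup>l / (k 2\<^sup>k)\<close> of its copies of \<open>Q\<^sub>l\<close>;
  average over all \<open>Q\<^sub>k\<close>. For the logarithmic bound, the missing edges of a \<open>Q\<close> of dimension \<open>k + 2\<close>
  must separate its coordinates, hence there are at least \<open>log\<^sub>2 (k + 2)\<close> of them, and the density of spoiled
  copies of \<open>Q\<^sub>l\<close> is at least that of the missing edges.
\<close>

subsection \<open>Copies of hypercubes are subcubes\<close>

text \<open>Two vertices at distance two in a hypercube have exactly two common neighbours. One of
  them is \<open>P\<close>, so the other, \<open>Q\<close>, is the opposite corner of the
  four-cycle.\<close>

lemma sym_diff_square:
  assumes "sym_diff Q (sym_diff P {a}) = {x}" "sym_diff Q (sym_diff P {b}) = {y}" "a \<noteq> b" "Q \<noteq> P"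
  shows "Q = sym_diff P {a, b}"
proof -
  have 1: "(z \<in> Q) = (z \<in> P) \<longleftrightarrow> (z = a) = (z = x)" for z
    using assms(1) by (auto simp: set_eq_iff)
  have 2: "(z \<in> Q) = (z \<in> P) \<longleftrightarrow> (z = b) = (z = y)" for z
    using assms(2) by (auto simp: set_eq_iff)
  have "x \<noteq> a"
  proof
    assume "x = a"
    then have "z \<in> Q \<longleftrightarrow> z \<in> P" for z using 1[of z] by simp
    then show False using assms(4) by blast
  qed
  \<comment> \<open>As \<open>x \<noteq> a\<close>, the first description makes \<open>Q\<close> and
    \<open>P\<close> differ at \<open>a\<close>; since \<open>a \<noteq> b\<close>, the second
    allows this only if \<open>y = a\<close>.\<close>
  then have "y = a"
    using 1[of a] 2[of a] assms(3) by metis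
  then have "z \<in> Q \<longleftrightarrow> z \<in> sym_diff P {a, b}" for z
    using 2[of z] assms(3) by auto
  then show ?thesis
    by blast
qed

lemma sym_diff_insert: "c \<notin> W \<Longrightarrow> sym_diff G (insert c W) = sym_diff (sym_diff G W) {c}"
  by auto

lemma sym_diff_insert2:
  "a \<notin> W \<Longrightarrow> b \<notin> W \<Longrightarrow> a \<noteq> b \<Longrightarrow>
    sym_diff G (insert a (insert b W)) = sym_diff (sym_diff G W) {a, b}"
  by auto

text \<open>The direction \<open>d i\<close> is read off at the empty set. It propagates upwards:
  for \<open>X = insert i (insert j Y)\<close>, the vertex \<open>g X\<close> is adjacent to
  \<open>g (insert i Y)\<close> and \<open>g (insert j Y)\<close> and differs from
  \<open>g Y\<close> by injectivity, so \<open>sym_diff_square\<close> determines it.\<close>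

lemma cube_embedding_directions:
  fixes g :: "'a set \<Rightarrow> 'b set"
  assumes "finite S" and inj: "inj_on g (Pow S)"
    and adj: "\<And>X i. X \<subseteq> S \<Longrightarrow> i \<in> S - X \<Longrightarrow> card (sym_diff (g (insert i X)) (g X)) = 1"
  shows "\<exists>d. inj_on d S \<and> (\<forall>X\<subseteq>S. g X = sym_diff (g {}) (d ` X))"
proof -
  have "\<exists>x. sym_diff (g {i}) (g {}) = {x}" if "i \<in> S" for i
    using adj[of "{}" i] that by (auto simp: card_1_singleton_iff)
  then obtain d where "\<And>i. i \<in> S \<Longrightarrow> sym_diff (g {i}) (g {}) = {d i}"
    by metis
  then have d: "g {i} = sym_diff (g {}) {d i}" if "i \<in> S" for i
    using that by blast
  have inj_d: "inj_on d S"
  proof (rule inj_onI)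
    fix i j assume "i \<in> S" "j \<in> S" "d i = d j"
    then have "g {i} = g {j}" using d by simp
    then show "i = j"
      using inj_onD[OF inj] \<open>i \<in> S\<close> \<open>j \<in> S\<close> by blast
  qed
  have "g X = sym_diff (g {}) (d ` X)" if "X \<subseteq> S" for X
    using that
  \<comment> \<open>The step needs three smaller sets at once, \<open>Y\<close>,
    \<open>insert i Y\<close> and \<open>insert j Y\<close>, hence strong induction on the
    size.\<close>
  proof (induction "card X" arbitrary: X rule: less_induct)
    case less
    have fin: "finite X" using less.prems assms(1) finite_subset by blast
    show ?case
    proof (cases "X = {}")
      case False
      then obtain i Z where i: "X = insert i Z" "i \<notin> Z" by (meson Set.set_insert ex_in_conv)
      show ?thesis
      proof (cases "Z = {}")
        case True
        then show ?thesis using i d less.prems by simp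
      next
        case False
        then obtain j Y where j: "Z = insert j Y" "j \<notin> Y" by (meson Set.set_insert ex_in_conv)
        have S: "i \<in> S" "j \<in> S" "Y \<subseteq> S" "i \<noteq> j" "i \<notin> Y" using i j less.prems by auto
        have finY: "finite Y" using fin i j by simp
        have IH: "g Y = sym_diff (g {}) (d ` Y)"
            "g (insert i Y) = sym_diff (g {}) (d ` insert i Y)"
            "g (insert j Y) = sym_diff (g {}) (d ` insert j Y)"
          by (rule less.hyps; use i j S finY in simp)+
        have dY: "d i \<notin> d ` Y" "d j \<notin> d ` Y" "d i \<noteq> d j"
          using inj_d S j by (auto simp: inj_on_def)
        have step: "g (insert i Y) = sym_diff (g Y) {d i}" "g (insert j Y) = sym_diff (g Y) {d j}"
          unfolding IH image_insert using sym_diff_insert dY by metis+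
        have "card (sym_diff (g X) (g (insert i Y))) = 1" "card (sym_diff (g X) (g (insert j Y))) = 1"
          using adj[of "insert i Y" j] adj[of "insert j Y" i] S i j by (auto simp: insert_commute)
        then obtain x y where "sym_diff (g X) (sym_diff (g Y) {d i}) = {x}"
            "sym_diff (g X) (sym_diff (g Y) {d j}) = {y}"
          unfolding step by (auto simp: card_1_singleton_iff)
        moreover have "g X \<noteq> g Y"
          using inj_onD[OF inj, of X Y] less.prems S i by auto
        ultimately have "g X = sym_diff (g Y) {d i, d j}"
          using sym_diff_square dY(3) by metis
        then show ?thesis
          unfolding IH(1) i j image_insert using sym_diff_insert2 dY by metis
      qed
    qed simp
  qed
  then show ?thesis using inj_d by blast
qed

section \<open>Vertices as sets of coordinates, and subcubes\<close>

definition supp :: "bool list \<Rightarrow> nat set" where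
  "supp u = {i. i < length u \<and> u ! i}"

definition indicator_list :: "nat \<Rightarrow> nat set \<Rightarrow> bool list" where
  "indicator_list n A = map (\<lambda>i. i \<in> A) [0..<n]"

lemma length_indicator_list [simp]: "length (indicator_list n A) = n"
  by (simp add: indicator_list_def)

lemma supp_indicator_list: "supp (indicator_list n A) = A \<inter> {..<n}"
  by (auto simp: supp_def indicator_list_def)

lemma supp_indicator_list_subset [simp]: "A \<subseteq> {..<n} \<Longrightarrow> supp (indicator_list n A) = A"
  by (auto simp: supp_indicator_list)

lemma indicator_list_supp [simp]: "length u = n \<Longrightarrow> indicator_list n (supp u) = u"
  by (auto simp: supp_def indicator_list_def intro!: nth_equalityI)

lemma supp_subset: "length u = n \<Longrightarrow> supp u \<subseteq> {..<n}"
  by (auto simp: supp_def)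

lemma supp_inject: "length u = length v \<Longrightarrow> supp u = supp v \<longleftrightarrow> u = v"
  by (metis indicator_list_supp)

lemma indicator_list_inject:
  "A \<subseteq> {..<n} \<Longrightarrow> B \<subseteq> {..<n} \<Longrightarrow> indicator_list n A = indicator_list n B \<longleftrightarrow> A = B"
  by (metis supp_indicator_list_subset)

lemma differing_positions:
  "length u = n \<Longrightarrow> length v = n \<Longrightarrow> {i. i < n \<and> u ! i \<noteq> v ! i} = sym_diff (supp u) (supp v)"
  by (auto simp: supp_def)

lemma verts_hypercube [simp]: "verts (hypercube n) = {u. length u = n}"
  by (simp add: hypercube_def)

lemma edges_hypercube_iff:
  assumes "length u = n" "length v = n"
  shows "{u, v} \<in> edges (hypercube n) \<longleftrightarrow> card (sym_diff (supp u) (supp v)) = 1"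
proof -
  have "{u, v} \<in> edges (hypercube n) \<longleftrightarrow>
      card {i. i < n \<and> u ! i \<noteq> v ! i} = 1 \<or> card {i. i < n \<and> v ! i \<noteq> u ! i} = 1"
    unfolding hypercube_def snd_conv mem_Collect_eq doubleton_eq_iff using assms by blast
  also have "\<dots> \<longleftrightarrow> card {i. i < n \<and> u ! i \<noteq> v ! i} = 1"
    by (simp add: eq_commute)
  finally show ?thesis
    by (simp only: differing_positions[OF assms])
qed

lemma edges_hypercube_cases:
  assumes "e \<in> edges (hypercube n)"
  obtains u v where "e = {u, v}" "length u = n" "length v = n"
  using assms by (auto simp: hypercube_def)

text \<open>The pair \<open>(F, B)\<close> stands for the subcube on the vertices whose support is \<open>B \<union> X\<close>
  with \<open>X \<subseteq> F\<close>: \<open>F\<close> is the set of free coordinates. The edges are the subcubes of dimension 1.\<close>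

type_synonym subcube = "nat set \<times> nat set"

definition subcubes :: "nat \<Rightarrow> nat \<Rightarrow> subcube set" where
  "subcubes n l = {(F, B). F \<subseteq> {..<n} \<and> card F = l \<and> B \<subseteq> {..<n} - F}"

text \<open>Containment of subcubes: the base points agree off the free coordinates of
  \<open>c\<close>, while on them \<open>x\<close> may be fixed to arbitrary values.\<close>

definition inside :: "subcube \<Rightarrow> subcube \<Rightarrow> bool" where
  "inside x c \<longleftrightarrow> fst x \<subseteq> fst c \<and> snd x - fst c = snd c"

definition edge_of :: "nat \<Rightarrow> subcube \<Rightarrow> bool list set" where
  "edge_of n x = {indicator_list n (snd x), indicator_list n (snd x \<union> fst x)}"

text \<open>This is an induced subgraph of the hypercube, although copies in general need not be
  induced; that copies of hypercubes are is part of
  \<open>subgraph_iso_hypercube_is_subcube\<close>.\<close>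

definition subcube_graph :: "nat \<Rightarrow> subcube \<Rightarrow> bool list ugraph" where
  "subcube_graph n c =
     ({u. length u = n \<and> supp u - fst c = snd c},
      {e \<in> edges (hypercube n). e \<subseteq> {u. length u = n \<and> supp u - fst c = snd c}})"

lemma edge_of_inj: "inj_on (edge_of n) (subcubes n 1)"
proof (rule inj_onI, clarify)
  fix F A F' A' assume *: "(F, A) \<in> subcubes n 1" "(F', A') \<in> subcubes n 1"
    and eq: "edge_of n (F, A) = edge_of n (F', A')"
  have sub: "A \<subseteq> {..<n}" "A \<union> F \<subseteq> {..<n}" "A' \<subseteq> {..<n}" "A' \<union> F' \<subseteq> {..<n}"
    and dj: "A \<inter> F = {}" "A' \<inter> F' = {}" "F \<noteq> {}" "F' \<noteq> {}"
    using * by (auto simp: subcubes_def)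
  have "supp ` edge_of n (F, A) = {A, A \<union> F}" "supp ` edge_of n (F', A') = {A', A' \<union> F'}"
    using sub by (auto simp: edge_of_def simp del: Un_subset_iff)
  then have "{A, A \<union> F} = {A', A' \<union> F'}" using eq by simp
  then show "F = F' \<and> A = A'"
    using dj by (auto simp: doubleton_eq_iff)
qed

lemma edge_of_image: "edge_of n ` subcubes n 1 = edges (hypercube n)"
proof (intro equalityI subsetI)
  fix e assume "e \<in> edge_of n ` subcubes n 1"
  then obtain F A where *: "(F, A) \<in> subcubes n 1" "e = edge_of n (F, A)" by auto
  then have sub: "A \<subseteq> {..<n}" "A \<union> F \<subseteq> {..<n}" "A \<inter> F = {}" "card F = 1"
    by (auto simp: subcubes_def)
  then have "sym_diff A (A \<union> F) = F" by auto
  then show "e \<in> edges (hypercube n)"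
    using * sub by (auto simp: edge_of_def edges_hypercube_iff simp del: Un_subset_iff)
next
  have main: "{u, v} \<in> edge_of n ` subcubes n 1"
    if "length u = n" "length v = n" "supp u - supp v = {}" "card (supp v - supp u) = 1" for u v
  proof
    show "(supp v - supp u, supp u) \<in> subcubes n 1"
      using that supp_subset[of u n] supp_subset[of v n] by (auto simp: subcubes_def)
    have "supp u \<union> (supp v - supp u) = supp v" using that by auto
    then show "{u, v} = edge_of n (supp v - supp u, supp u)"
      using that by (simp add: edge_of_def)
  qed
  fix e assume e: "e \<in> edges (hypercube n)"
  then obtain u v where uv: "e = {u, v}" "length u = n" "length v = n"
    by (rule edges_hypercube_cases)
  then have "card (sym_diff (supp u) (supp v)) = 1" using e edges_hypercube_iff by blast
  then obtain i where i: "sym_diff (supp u) (supp v) = {i}" by (metis card_1_singletonE)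
  \<comment> \<open>Two disjoint sets whose union is a singleton: one of them is empty, so one
    support contains the other.\<close>
  have "(supp u - supp v) \<inter> (supp v - supp u) = {}" by blast
  then consider "supp u - supp v = {}" "supp v - supp u = {i}"
    | "supp v - supp u = {}" "supp u - supp v = {i}"
    using i unfolding Un_singleton_iff by force
  then show "e \<in> edge_of n ` subcubes n 1"
  proof cases
    case 1
    then show ?thesis using main[of u v] uv by simp
  next
    case 2
    then show ?thesis using main[of v u] uv by (simp add: insert_commute)
  qed
qed

lemma edge_of_subset_subcube_graph_iff:
  assumes "x \<in> subcubes n 1" "c \<in> subcubes n l"
  shows "edge_of n x \<subseteq> verts (subcube_graph n c) \<longleftrightarrow> inside x c"
proof -
  obtain F A where x: "x = (F, A)" by fastforce
  obtain F' B where c: "c = (F', B)" by fastforce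
  have "A \<subseteq> {..<n}" "A \<union> F \<subseteq> {..<n}" "A \<inter> F = {}" "F' \<inter> B = {}"
    using assms x c by (auto simp: subcubes_def)
  then show ?thesis
    unfolding x c
    by (auto simp: edge_of_def subcube_graph_def inside_def simp del: Un_subset_iff)
qed

lemma edges_subcube_graph:
  assumes "c \<in> subcubes n l"
  shows "edges (subcube_graph n c) = edge_of n ` {x \<in> subcubes n 1. inside x c}"
proof -
  have "edges (subcube_graph n c) = {e \<in> edge_of n ` subcubes n 1. e \<subseteq> verts (subcube_graph n c)}"
    unfolding edge_of_image by (simp add: subcube_graph_def)
  also have "\<dots> = edge_of n ` {x \<in> subcubes n 1. inside x c}"
    using edge_of_subset_subcube_graph_iff[OF _ assms] by auto
  finally show ?thesis .
qed

text \<open>The supports form an interval of the Boolean lattice, whose ends recover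
  \<open>B\<close> and \<open>F\<close>; injectivity of \<open>subcube_graph\<close> rests on
  this.\<close>

lemma verts_subcube_graph_supp:
  assumes "(F, B) \<in> subcubes n l"
  shows "supp ` verts (subcube_graph n (F, B)) = {B..B \<union> F}"
proof (intro equalityI subsetI)
  fix Y assume Y: "Y \<in> {B..B \<union> F}"
  moreover have BF: "B \<inter> F = {}" "B \<union> F \<subseteq> {..<n}" using assms by (auto simp: subcubes_def)
  ultimately have "Y \<subseteq> {..<n}" "Y - F = B" by auto
  then show "Y \<in> supp ` verts (subcube_graph n (F, B))"
    by (intro image_eqI[of _ _ "indicator_list n Y"]) (auto simp: subcube_graph_def)
qed (auto simp: subcube_graph_def)

lemma subcube_graph_inj: "inj_on (subcube_graph n) (subcubes n l)"
proof (rule inj_onI, clarify)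
  fix F B F' B' assume *: "(F, B) \<in> subcubes n l" "(F', B') \<in> subcubes n l"
    and "subcube_graph n (F, B) = subcube_graph n (F', B')"
  then have "{B..B \<union> F} = {B'..B' \<union> F'}"
    using verts_subcube_graph_supp by metis
  then have "B = B'" "B \<union> F = B' \<union> F'" by (auto simp: Icc_eq_Icc)
  moreover have "B \<inter> F = {}" "B' \<inter> F' = {}" using * by (auto simp: subcubes_def)
  ultimately show "F = F' \<and> B = B'" by auto
qed

lemma subcube_graph_is_subgraph: "is_subgraph (subcube_graph n c) (hypercube n)"
  using is_ugraph_hypercube[of n]
  by (simp add: is_subgraph_def is_ugraph_def subcube_graph_def subset_eq)

lemma graph_iso_sym: "graph_iso G H \<Longrightarrow> graph_iso H G"
proof -
  assume "graph_iso G H"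
  then obtain f where f: "bij_betw f (verts G) (verts H)"
    "\<And>u v. u \<in> verts G \<Longrightarrow> v \<in> verts G \<Longrightarrow> {u, v} \<in> edges G \<longleftrightarrow> {f u, f v} \<in> edges H"
    unfolding graph_iso_def by blast
  let ?g = "inv_into (verts G) f"
  have g: "bij_betw ?g (verts H) (verts G)"
    using f(1) by (rule bij_betw_inv_into)
  have "{u, v} \<in> edges H \<longleftrightarrow> {?g u, ?g v} \<in> edges G" if "u \<in> verts H" "v \<in> verts H" for u v
    using f(2)[of "?g u" "?g v"] that g bij_betw_inv_into_right[OF f(1)]
    by (simp add: bij_betwE)
  then show "graph_iso H G" unfolding graph_iso_def using g by blast
qed

lemma sym_diff_cancel:
  assumes "sym_diff A X = sym_diff A Y"
  shows "X = Y"
proof -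
  have "z \<in> sym_diff A X \<longleftrightarrow> (z \<in> A) \<noteq> (z \<in> X)" "z \<in> sym_diff A Y \<longleftrightarrow> (z \<in> A) \<noteq> (z \<in> Y)" for z
    by auto
  then have "z \<in> X \<longleftrightarrow> z \<in> Y" for z
    using assms by metis
  then show ?thesis by auto
qed

text \<open>Relabelling coordinates by \<open>d\<close> and translating by \<open>A\<close>
  preserves symmetric differences up to the relabelling, hence adjacency. This serves both to embed
  the standard cube onto a given subcube and to identify the image of an arbitrary copy.
  \<open>A\<close> may meet the range of \<open>d\<close>, so the base point of \<open>c\<close> is
  \<open>A\<close> with that range removed.\<close>

lemma directed_map_image:
  assumes d: "inj_on d {..<l}" "d ` {..<l} \<subseteq> {..<n}" and A: "A \<subseteq> {..<n}"
    and f: "\<And>u. length u = l \<Longrightarrow> length (f u) = n \<and> supp (f u) = sym_diff A (d ` supp u)"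
  defines "c \<equiv> (d ` {..<l}, A - d ` {..<l})"
  shows "c \<in> subcubes n l"
    and "bij_betw f (verts (hypercube l)) (verts (subcube_graph n c))"
    and "\<And>u v. length u = l \<Longrightarrow> length v = l \<Longrightarrow>
           {u, v} \<in> edges (hypercube l) \<longleftrightarrow> {f u, f v} \<in> edges (hypercube n)"
proof -
  show "c \<in> subcubes n l"
    using d A by (auto simp: c_def subcubes_def card_image)
  have d_eq: "d ` X = d ` Y \<longleftrightarrow> X = Y" if "X \<subseteq> {..<l}" "Y \<subseteq> {..<l}" for X Y
    using inj_on_image_eq_iff[OF d(1) that] .
  show "bij_betw f (verts (hypercube l)) (verts (subcube_graph n c))"
  proof (rule bij_betw_imageI)
    show "inj_on f (verts (hypercube l))"
    proof (rule inj_onI)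
      fix u v assume uv: "u \<in> verts (hypercube l)" "v \<in> verts (hypercube l)" "f u = f v"
      then have len: "length u = l" "length v = l" by auto
      have "supp (f u) = supp (f v)" using uv(3) by simp
      then have "sym_diff A (d ` supp u) = sym_diff A (d ` supp v)"
        using f[OF len(1)] f[OF len(2)] by simp
      then have "d ` supp u = d ` supp v" by (rule sym_diff_cancel)
      then have "supp u = supp v"
        using d_eq supp_subset[OF len(1)] supp_subset[OF len(2)] by simp
      then show "u = v" using supp_inject len by simp
    qed
    show "f ` verts (hypercube l) = verts (subcube_graph n c)"
    proof (intro equalityI subsetI)
      fix w assume "w \<in> f ` verts (hypercube l)"
      then obtain u where u: "length u = l" "w = f u" by auto
      have "d ` supp u \<subseteq> d ` {..<l}" using supp_subset[OF u(1)] by auto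
      then show "w \<in> verts (subcube_graph n c)"
        using f[OF u(1)] u(2) by (auto simp: subcube_graph_def c_def)
    next
      fix w assume "w \<in> verts (subcube_graph n c)"
      then have w: "length w = n" "supp w - d ` {..<l} = A - d ` {..<l}"
        by (auto simp: subcube_graph_def c_def)
      \<comment> \<open>The preimage of \<open>w\<close> flips exactly the directions in which
        \<open>w\<close> deviates from \<open>A\<close>; outside the range of \<open>d\<close> the
        two agree.\<close>
      define X where "X = {i. i < l \<and> d i \<in> sym_diff A (supp w)}"
      have dX: "d ` X = sym_diff A (supp w)"
        using w(2) by (auto simp: X_def image_iff)
      let ?u = "indicator_list l X"
      have "supp ?u = X" by (rule supp_indicator_list_subset) (auto simp: X_def)
      then have "supp (f ?u) = supp w" "length (f ?u) = n"
        using f[of ?u] dX by auto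
      then have "f ?u = w" using w(1) supp_inject by metis
      then show "w \<in> f ` verts (hypercube l)" by force
    qed
  qed
  fix u v :: "bool list" assume uv: "length u = l" "length v = l"
  have s: "supp u \<subseteq> {..<l}" "supp v \<subseteq> {..<l}" using supp_subset[OF uv(1)] supp_subset[OF uv(2)] by auto
  have "sym_diff (supp (f u)) (supp (f v)) = sym_diff (d ` supp u) (d ` supp v)"
    using f uv by auto
  also have "\<dots> = d ` sym_diff (supp u) (supp v)"
    unfolding image_Un using inj_on_image_set_diff[OF d(1)] s by (metis Diff_subset subset_trans)
  finally have "card (sym_diff (supp (f u)) (supp (f v))) = card (sym_diff (supp u) (supp v))"
    using card_image[OF inj_on_subset[OF d(1)], of "sym_diff (supp u) (supp v)"] s
    by (metis Diff_subset Un_least subset_trans)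
  then show "{u, v} \<in> edges (hypercube l) \<longleftrightarrow> {f u, f v} \<in> edges (hypercube n)"
    using uv f by (simp add: edges_hypercube_iff)
qed

lemma graph_iso_subcube_graph:
  assumes "(F, B) \<in> subcubes n l"
  shows "graph_iso (subcube_graph n (F, B)) (hypercube l)"
proof -
  have F: "F \<subseteq> {..<n}" "card F = l" "B \<subseteq> {..<n}" "B \<inter> F = {}" "finite F"
    using assms finite_subset by (auto simp: subcubes_def)
  obtain d where d: "bij_betw d {..<l} F"
    using F ex_bij_betw_nat_finite[of F] by (auto simp: lessThan_atLeast0)
  then have d': "inj_on d {..<l}" "d ` {..<l} = F" by (auto simp: bij_betw_def)
  define f where "f u = indicator_list n (sym_diff B (d ` supp u))" for u
  have f: "length (f u) = n \<and> supp (f u) = sym_diff B (d ` supp u)" if "length u = l" for u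
  proof -
    have "d ` supp u \<subseteq> F" using supp_subset[OF that] d'(2) by blast
    then show ?thesis unfolding f_def using F by (auto simp: supp_indicator_list)
  qed
  have "B - F = B" using F by blast
  note * = directed_map_image[OF d'(1) _ F(3) f, unfolded d'(2), OF F(1), unfolded this]
  have "bij_betw f (verts (hypercube l)) (verts (subcube_graph n (F, B)))" using *(2) .
  moreover have "{u, v} \<in> edges (hypercube l) \<longleftrightarrow> {f u, f v} \<in> edges (subcube_graph n (F, B))"
    if "u \<in> verts (hypercube l)" "v \<in> verts (hypercube l)" for u v
  proof -
    have "f u \<in> verts (subcube_graph n (F, B))" "f v \<in> verts (subcube_graph n (F, B))"
      using calculation that by (auto simp: bij_betw_def)
    then show ?thesis
      using *(3)[of u v] that by (auto simp: subcube_graph_def)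
  qed
  ultimately have "graph_iso (hypercube l) (subcube_graph n (F, B))"
    unfolding graph_iso_def by blast
  then show ?thesis by (rule graph_iso_sym)
qed

text \<open>In a four-cycle of a hypercube opposite edges flip the same coordinate, so a copy of a
  hypercube is determined by one of its vertices and the coordinates flipped there.\<close>

lemma subgraph_iso_hypercube_is_subcube:
  assumes "is_subgraph S (hypercube n)" "graph_iso S (hypercube l)"
  shows "S \<in> subcube_graph n ` subcubes n l"
proof -
  from graph_iso_sym[OF assms(2)] obtain f where
    f: "bij_betw f {u. length u = l} (verts S)"
    and fe: "\<And>u v. length u = l \<Longrightarrow> length v = l \<Longrightarrow>
      {u, v} \<in> edges (hypercube l) \<longleftrightarrow> {f u, f v} \<in> edges S"
    unfolding graph_iso_def by auto
  have S: "\<And>w. w \<in> verts S \<Longrightarrow> length w = n" "edges S \<subseteq> edges (hypercube n)" "is_ugraph S"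
    using assms(1) by (auto simp: is_subgraph_def)
  have len: "length (f u) = n" if "length u = l" for u
    using that f S(1) by (auto simp: bij_betw_def)
  define g where "g X = supp (f (indicator_list l X))" for X
  have g_sub: "g X \<subseteq> {..<n}" for X unfolding g_def by (rule supp_subset) (simp add: len)
  have "\<exists>d. inj_on d {..<l} \<and> (\<forall>X\<subseteq>{..<l}. g X = sym_diff (g {}) (d ` X))"
  proof (rule cube_embedding_directions)
    show "inj_on g (Pow {..<l})"
    proof (rule inj_onI)
      fix X Y assume XY: "X \<in> Pow {..<l}" "Y \<in> Pow {..<l}" "g X = g Y"
      then have "f (indicator_list l X) = f (indicator_list l Y)"
        unfolding g_def using supp_inject len length_indicator_list by metis
      then have "indicator_list l X = indicator_list l Y"
        using f by (auto simp: bij_betw_def inj_on_def)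
      then show "X = Y" using XY indicator_list_inject by auto
    qed
    fix X i assume X: "X \<subseteq> {..<l}" "i \<in> {..<l} - X"
    let ?u = "indicator_list l (insert i X)" and ?v = "indicator_list l X"
    have "sym_diff (supp ?u) (supp ?v) = {i}"
      using X by auto
    then have "{?u, ?v} \<in> edges (hypercube l)" by (subst edges_hypercube_iff) auto
    then have "{f ?u, f ?v} \<in> edges (hypercube n)" using fe S(2) by auto
    then show "card (sym_diff (g (insert i X)) (g X)) = 1"
      unfolding g_def using len by (simp add: edges_hypercube_iff)
  qed simp
  then obtain d where d: "inj_on d {..<l}" "\<And>X. X \<subseteq> {..<l} \<Longrightarrow> g X = sym_diff (g {}) (d ` X)"
    by blast
  have "d i < n" if "i < l" for i
  proof -
    have "d i \<in> g {i} \<union> g {}" using d(2)[of "{i}"] that by auto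
    then show ?thesis using g_sub by blast
  qed
  then have dn: "d ` {..<l} \<subseteq> {..<n}" by auto
  have fg: "length (f u) = n \<and> supp (f u) = sym_diff (g {}) (d ` supp u)" if "length u = l" for u
    using d(2)[of "supp u"] that len supp_subset[OF that] by (simp add: g_def)
  define c where "c = (d ` {..<l}, g {} - d ` {..<l})"
  note * = directed_map_image[OF d(1) dn g_sub fg, folded c_def]
  have V: "verts S = verts (subcube_graph n c)"
    using *(2) f by (auto simp: bij_betw_def)
  \<comment> \<open>One inclusion holds because the subcube is induced. For the other, an edge of
    the hypercube between vertices of \<open>S\<close> pulls back along \<open>f\<close> to an edge
    of the \<open>l\<close>-cube, which \<open>f\<close> maps to an edge of
    \<open>S\<close>.\<close>
  have "edges S = edges (subcube_graph n c)"
  proof (intro equalityI subsetI)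
    fix e assume "e \<in> edges S"
    then show "e \<in> edges (subcube_graph n c)"
      using S V by (auto simp: subcube_graph_def is_ugraph_def)
  next
    fix e assume "e \<in> edges (subcube_graph n c)"
    then have e: "e \<in> edges (hypercube n)" "e \<subseteq> f ` {u. length u = l}"
      using V f by (auto simp: subcube_graph_def bij_betw_def)
    then obtain a b where "e = {a, b}" using edges_hypercube_cases by metis
    then obtain u v where "length u = l" "length v = l" "e = {f u, f v}"
      using e(2) by auto
    then show "e \<in> edges S" using e(1) fe *(3) by auto
  qed
  then have "S = subcube_graph n c" using V by (simp add: prod_eq_iff)
  then show ?thesis using *(1) by blast
qed

section \<open>The extremal problem in terms of missing edges\<close>

definition missing :: "nat \<Rightarrow> bool list ugraph \<Rightarrow> subcube set" where
  "missing n G = {x \<in> subcubes n 1. edge_of n x \<notin> edges G}"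

definition avoiding :: "nat \<Rightarrow> nat \<Rightarrow> subcube set \<Rightarrow> subcube set" where
  "avoiding n l M = {c \<in> subcubes n l. \<forall>x\<in>M. \<not> inside x c}"

text \<open>\<open>missing\<close> records edges only, so the vertices of a copy are recovered as
  endpoints of its edges. A cube of dimension 0 is an isolated vertex, whence
  \<open>l \<ge> 1\<close>.\<close>

lemma subcube_vertex_in_edge:
  assumes c: "c \<in> subcubes n l" and l: "l \<ge> 1" and v: "v \<in> verts (subcube_graph n c)"
  shows "v \<in> \<Union> (edges (subcube_graph n c))"
proof -
  obtain F B where FB: "c = (F, B)" by fastforce
  obtain i where i: "i \<in> F" using c l FB by (fastforce simp: subcubes_def)
  let ?x = "({i}, supp v - {i})"
  have v': "length v = n" "supp v - F = B" using v FB by (auto simp: subcube_graph_def)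
  have "?x \<in> subcubes n 1" "inside ?x c"
    using c v' i FB supp_subset[OF v'(1)] by (auto simp: subcubes_def inside_def)
  moreover have "v \<in> edge_of n ?x"
  proof (cases "i \<in> supp v")
    case True
    then have "supp v - {i} \<union> {i} = supp v" by auto
    then show ?thesis using v' by (simp add: edge_of_def)
  next
    case False
    then have "supp v - {i} = supp v" by auto
    then show ?thesis using v' by (simp add: edge_of_def)
  qed
  ultimately show ?thesis unfolding edges_subcube_graph[OF c] by blast
qed

lemma copies_hypercube:
  assumes G: "is_subgraph G (hypercube n)" and l: "l \<ge> 1"
  shows "copies G (hypercube l) = subcube_graph n ` avoiding n l (missing n G)"
proof (intro equalityI subsetI)
  fix S assume "S \<in> copies G (hypercube l)"
  then have S: "is_subgraph S G" "graph_iso S (hypercube l)" by (auto simp: copies_def)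
  then have "is_subgraph S (hypercube n)" using G by (auto simp: is_subgraph_def)
  then obtain c where c: "c \<in> subcubes n l" "S = subcube_graph n c"
    using subgraph_iso_hypercube_is_subcube S(2) by blast
  have "edges (subcube_graph n c) \<subseteq> edges G" using S c by (simp add: is_subgraph_def)
  then have "c \<in> avoiding n l (missing n G)"
    using c by (auto simp: avoiding_def missing_def edges_subcube_graph[OF c(1)])
  then show "S \<in> subcube_graph n ` avoiding n l (missing n G)" using c by blast
next
  fix S assume "S \<in> subcube_graph n ` avoiding n l (missing n G)"
  then obtain c where c: "c \<in> subcubes n l" "\<forall>x\<in>missing n G. \<not> inside x c"
    and S: "S = subcube_graph n c" by (auto simp: avoiding_def)
  have e: "edges S \<subseteq> edges G"
    using c by (auto simp: S edges_subcube_graph[OF c(1)] missing_def)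
  moreover have "verts S \<subseteq> verts G"
  proof
    fix v assume "v \<in> verts S"
    then have "v \<in> \<Union> (edges G)" using subcube_vertex_in_edge[OF c(1) l] S e by blast
    then show "v \<in> verts G" using G by (auto simp: is_subgraph_def is_ugraph_def)
  qed
  ultimately have "is_subgraph S G"
    using G S subcube_graph_is_subgraph[of n c] by (auto simp: is_subgraph_def)
  moreover have "graph_iso S (hypercube l)"
    using graph_iso_subcube_graph c S by (cases c) auto
  ultimately show "S \<in> copies G (hypercube l)" by (simp add: copies_def)
qed

lemma num_copies_hypercube:
  assumes "is_subgraph G (hypercube n)" "l \<ge> 1"
  shows "num_copies G (hypercube l) = card (avoiding n l (missing n G))"
  unfolding num_copies_def copies_hypercube[OF assms]
  by (rule card_image) (rule inj_on_subset[OF subcube_graph_inj], auto simp: avoiding_def)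

lemma graph_free_hypercube_iff:
  assumes "is_subgraph G (hypercube n)" "k \<ge> 1"
  shows "graph_free G (hypercube k) \<longleftrightarrow> avoiding n k (missing n G) = {}"
proof -
  have "graph_free G (hypercube k) \<longleftrightarrow> copies G (hypercube k) = {}"
    by (auto simp: graph_free_def copies_def)
  then show ?thesis by (simp add: copies_hypercube[OF assms])
qed

lemma num_copies_hypercube_hypercube:
  assumes "l \<ge> 1"
  shows "num_copies (hypercube n) (hypercube l) = card (subcubes n l)"
proof -
  have "missing n (hypercube n) = {}" using edge_of_image by (auto simp: missing_def)
  moreover have "is_subgraph (hypercube n) (hypercube n)"
    by (simp add: is_subgraph_def is_ugraph_hypercube)
  ultimately show ?thesis using num_copies_hypercube assms by (simp add: avoiding_def)
qed

lemma exists_subgraph_missing: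
  assumes "M \<subseteq> subcubes n 1"
  shows "\<exists>G. is_subgraph G (hypercube n) \<and> missing n G = M"
proof (intro exI conjI)
  let ?G = "(verts (hypercube n), edges (hypercube n) - edge_of n ` M)"
  show "is_subgraph ?G (hypercube n)"
    using is_ugraph_hypercube[of n] by (auto simp: is_subgraph_def is_ugraph_def)
  have "missing n ?G = {x \<in> subcubes n 1. edge_of n x \<in> edge_of n ` M}"
    using edge_of_image[of n] by (auto simp: missing_def simp del: One_nat_def)
  also have "\<dots> = {x \<in> subcubes n 1. x \<in> M}"
    using inj_on_image_mem_iff[OF edge_of_inj _ assms] by blast
  finally show "missing n ?G = M"
    using assms by blast
qed

lemma verts_hypercube_nonempty: "verts (hypercube k) \<noteq> {}"
proof -
  have "replicate k True \<in> verts (hypercube k)" by simp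
  then show ?thesis by blast
qed

text \<open>With \<open>ex_num_hypercube_ge\<close> this replaces graphs by sets \<open>M\<close> of
  edges meeting every \<open>k\<close>-subcube: the extremal number is the largest
  \<open>card (avoiding n l M)\<close>.\<close>

lemma ex_num_hypercube_attained:
  assumes "k \<ge> 1" "l \<ge> 1"
  obtains M where "M \<subseteq> subcubes n 1" "avoiding n k M = {}"
    "ex_num (hypercube n) (hypercube l) (hypercube k) = card (avoiding n l M)"
proof -
  obtain G where G: "is_subgraph G (hypercube n)" "graph_free G (hypercube k)"
    "ex_num (hypercube n) (hypercube l) (hypercube k) = num_copies G (hypercube l)"
    using ex_num_attained[OF is_ugraph_hypercube finite_verts_hypercube verts_hypercube_nonempty] .
  show thesis
    using that[of "missing n G"] G num_copies_hypercube[OF G(1) assms(2)]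
      graph_free_hypercube_iff[OF G(1) assms(1)] by (auto simp: missing_def)
qed

lemma ex_num_hypercube_ge:
  assumes "k \<ge> 1" "l \<ge> 1" "M \<subseteq> subcubes n 1" "avoiding n k M = {}"
  shows "card (avoiding n l M) \<le> ex_num (hypercube n) (hypercube l) (hypercube k)"
proof -
  obtain G where G: "is_subgraph G (hypercube n)" "missing n G = M"
    using exists_subgraph_missing[OF assms(3)] by blast
  have "graph_free G (hypercube k)" using graph_free_hypercube_iff[OF G(1) assms(1)] G assms by simp
  then show ?thesis
    using ex_num_upper[OF is_ugraph_hypercube finite_verts_hypercube verts_hypercube_nonempty G(1)]
      num_copies_hypercube[OF G(1) assms(2)] G(2) by metis
qed

subsection \<open>Counting incidences of subcubes\<close>

lemma finite_subcubes [simp]: "finite (subcubes n l)"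
proof (rule finite_subset)
  show "subcubes n l \<subseteq> Pow {..<n} \<times> Pow {..<n}"
    by (auto simp: subcubes_def)
qed simp

lemma whole_cube_in_subcubes: "({..<n}, {}) \<in> subcubes n n"
  by (simp add: subcubes_def)

lemma inside_whole_cube: "x \<in> subcubes n l \<Longrightarrow> inside x ({..<n}, {})"
  by (auto simp: subcubes_def inside_def)

text \<open>Choose the \<open>j\<close> coordinates that stay free, then a value for each of the
  other \<open>m - j\<close> free coordinates of \<open>c\<close>; \<open>Y\<close> collects those
  set to 1.\<close>

lemma card_inside_subcubes:
  assumes c: "c \<in> subcubes n m"
  shows "card {x \<in> subcubes n j. inside x c} = (m choose j) * 2 ^ (m - j)"
proof -
  obtain F B where FB: "c = (F, B)" by fastforce
  have F: "F \<subseteq> {..<n}" "card F = m" "B \<subseteq> {..<n}" "B \<inter> F = {}" "finite F"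
    using c FB finite_subset by (auto simp: subcubes_def)
  let ?S = "SIGMA F':{F'. F' \<subseteq> F \<and> card F' = j}. Pow (F - F')"
  let ?f = "\<lambda>(F', Y). (F', B \<union> Y)"
  have inj: "inj_on ?f ?S"
    using F(4) by (auto simp: inj_on_def)
  have "?f ` ?S = {x \<in> subcubes n j. inside x c}"
  proof (intro equalityI subsetI)
    fix x assume "x \<in> {x \<in> subcubes n j. inside x c}"
    moreover obtain F' A where x: "x = (F', A)" by fastforce
    ultimately have *: "F' \<subseteq> F" "card F' = j" "A - F = B" "A \<inter> F' = {}"
      using FB by (auto simp: subcubes_def inside_def)
    then have "(F', A \<inter> F) \<in> ?S" by auto
    moreover have "x = ?f (F', A \<inter> F)" using * x by auto
    ultimately show "x \<in> ?f ` ?S" by blast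
  next
    fix x assume "x \<in> ?f ` ?S"
    then obtain F' Y where "x = (F', B \<union> Y)" "F' \<subseteq> F" "card F' = j" "Y \<subseteq> F - F'" by auto
    then show "x \<in> {x \<in> subcubes n j. inside x c}"
      using F FB by (auto simp: subcubes_def inside_def)
  qed
  then have "card {x \<in> subcubes n j. inside x c} = card ?S"
    using card_image[OF inj] by (simp only:)
  also have "\<dots> = (\<Sum>F' | F' \<subseteq> F \<and> card F' = j. card (Pow (F - F')))"
    using F(5) by (intro card_SigmaI) auto
  also have "\<dots> = (\<Sum>F' | F' \<subseteq> F \<and> card F' = j. 2 ^ (m - j))"
  proof (rule sum.cong[OF refl])
    fix F' assume "F' \<in> {F'. F' \<subseteq> F \<and> card F' = j}"
    then show "card (Pow (F - F')) = 2 ^ (m - j)"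
      using F finite_subset[of F' F] by (simp add: card_Pow card_Diff_subset)
  qed
  also have "\<dots> = (m choose j) * 2 ^ (m - j)"
    using n_subsets[OF F(5), of j] F(2) by simp
  finally show ?thesis .
qed

text \<open>Only the set \<open>Z\<close> of \<open>l - j\<close> further coordinates to be freed is
  chosen. Freed coordinates leave the base point, hence \<open>A - Z\<close>.\<close>

lemma card_between_subcubes:
  assumes x: "x \<in> subcubes n j" and c: "c \<in> subcubes n m" and xc: "inside x c" and "j \<le> l"
  shows "card {y \<in> subcubes n l. inside x y \<and> inside y c} = (m - j) choose (l - j)"
proof -
  obtain F' A where xA: "x = (F', A)" by fastforce
  obtain F B where cB: "c = (F, B)" by fastforce
  have F: "F \<subseteq> {..<n}" "card F = m" "finite F"
    using c cB finite_subset by (auto simp: subcubes_def)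
  have F': "F' \<subseteq> F" "card F' = j" "A \<inter> F' = {}" "A \<subseteq> {..<n}" "A - F = B"
    using x xA xc cB by (auto simp: subcubes_def inside_def)
  have finF': "finite F'" using F F' finite_subset by blast
  let ?S = "{Z. Z \<subseteq> F - F' \<and> card Z = l - j}"
  let ?f = "\<lambda>Z. (F' \<union> Z, A - Z)"
  have inj: "inj_on ?f ?S"
    by (rule inj_onI) blast
  have "?f ` ?S = {y \<in> subcubes n l. inside x y \<and> inside y c}"
  proof (intro equalityI subsetI)
    fix y assume "y \<in> {y \<in> subcubes n l. inside x y \<and> inside y c}"
    moreover obtain G D where y: "y = (G, D)" by fastforce
    ultimately have *: "F' \<subseteq> G" "G \<subseteq> F" "card G = l" "A - G = D"
      using xA cB by (auto simp: subcubes_def inside_def)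
    then have "G - F' \<in> ?S" using F'(2) finF' by (auto simp: card_Diff_subset)
    moreover have "y = ?f (G - F')" using * F'(3) y by auto
    ultimately show "y \<in> ?f ` ?S" by blast
  next
    fix y assume "y \<in> ?f ` ?S"
    then obtain Z where Z: "y = (F' \<union> Z, A - Z)" "Z \<subseteq> F - F'" "card Z = l - j" by auto
    have "finite Z" using Z(2) F(3) finite_subset by blast
    moreover have "F' \<inter> Z = {}" using Z(2) by auto
    ultimately have "card (F' \<union> Z) = l"
      using finF' Z(3) F'(2) \<open>j \<le> l\<close> by (simp add: card_Un_disjoint)
    then show "y \<in> {y \<in> subcubes n l. inside x y \<and> inside y c}"
      using F F' Z xA cB by (auto simp: subcubes_def inside_def)
  qed
  then have "card {y \<in> subcubes n l. inside x y \<and> inside y c} = card ?S"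
    using card_image[OF inj] by (simp only:)
  also have "\<dots> = (m - j) choose (l - j)"
    using n_subsets[of "F - F'" "l - j"] F F' finF' by (simp add: card_Diff_subset)
  finally show ?thesis .
qed

lemma card_containing_subcubes:
  assumes "x \<in> subcubes n j" "j \<le> l"
  shows "card {y \<in> subcubes n l. inside x y} = (n - j) choose (l - j)"
proof -
  have "{y \<in> subcubes n l. inside x y} =
      {y \<in> subcubes n l. inside x y \<and> inside y ({..<n}, {})}"
    using inside_whole_cube by blast
  then show ?thesis
    using card_between_subcubes[OF assms(1) whole_cube_in_subcubes inside_whole_cube[OF assms(1)] assms(2)]
    by simp
qed

lemma card_subcubes: "card (subcubes n l) = (n choose l) * 2 ^ (n - l)"
proof -
  have "{x \<in> subcubes n l. inside x ({..<n}, {})} = subcubes n l"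
    using inside_whole_cube by blast
  then show ?thesis
    using card_inside_subcubes[OF whole_cube_in_subcubes, of n l] by simp
qed

lemma sum_card_inside:
  assumes "X \<subseteq> subcubes n j" "j \<le> m"
  shows "(\<Sum>c\<in>subcubes n m. card {x \<in> X. inside x c}) = card X * ((n - j) choose (m - j))"
proof -
  have "finite X" using assms(1) finite_subset finite_subcubes by blast
  then have "(\<Sum>c\<in>subcubes n m. card {x \<in> X. inside x c}) =
      (\<Sum>x\<in>X. (n - j) choose (m - j))"
    using assms card_containing_subcubes by (intro sum_multicount_gen) auto
  then show ?thesis by simp
qed

lemma card_subcubes_incidence:
  assumes "j \<le> m"
  shows "card (subcubes n m) * ((m choose j) * 2 ^ (m - j)) =
    card (subcubes n j) * ((n - j) choose (m - j))"
  using sum_card_inside[OF order_refl assms, of n] card_inside_subcubes by simp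

text \<open>Averaging over all \<open>m\<close>-subcubes. Each member of \<open>X\<close> lies in
  \<open>N\<close> of them, and each of them has \<open>D\<close> faces of dimension
  \<open>j\<close>; the incidence identity relates the totals, and \<open>m \<le> n\<close> makes
  \<open>N\<close> positive so that it cancels.\<close>

lemma local_density_le:
  fixes s :: real
  assumes X: "X \<subseteq> subcubes n j" and jm: "j \<le> m" "m \<le> n"
    and s: "\<And>c. c \<in> subcubes n m \<Longrightarrow> s \<le> card {x \<in> X. inside x c}"
  shows "s * card (subcubes n j) \<le> card X * ((m choose j) * 2 ^ (m - j))"
proof -
  define N where "N = (n - j) choose (m - j)"
  define D where "D = (m choose j) * 2 ^ (m - j)"
  have "N > 0" using jm by (simp add: N_def)
  have inc: "real (card (subcubes n m)) * D = real (card (subcubes n j)) * N"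
    using card_subcubes_incidence[OF jm(1), of n] unfolding N_def D_def of_nat_mult[symmetric] by simp
  have "card (subcubes n m) * s \<le> (\<Sum>c\<in>subcubes n m. real (card {x \<in> X. inside x c}))"
    using s by (intro sum_bounded_below)
  also have "\<dots> = real (card X) * N"
    using sum_card_inside[OF X jm(1)] unfolding N_def of_nat_sum[symmetric] of_nat_mult[symmetric] by simp
  finally have "(card (subcubes n m) * s) * D \<le> (real (card X) * N) * D"
    by (rule mult_right_mono) simp
  moreover have "(card (subcubes n m) * s) * D = (s * card (subcubes n j)) * N"
    using inc by (metis mult.assoc mult.commute)
  moreover have "(real (card X) * N) * D = (real (card X) * D) * N" by simp
  ultimately have "s * card (subcubes n j) \<le> real (card X) * D"
    using \<open>N > 0\<close> by simp
  then show ?thesis by (simp add: D_def)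
qed

text \<open>A normalized matching inequality: a member of \<open>M\<close> has \<open>N\<close>
  subcubes of dimension \<open>l\<close> above it, all in \<open>K\<close>, while a member of
  \<open>K\<close> has at most \<open>D\<close> members of \<open>M\<close> below it.\<close>

lemma up_closed_density_mono:
  assumes M: "M \<subseteq> subcubes n j" and K: "K \<subseteq> subcubes n l" and jl: "j \<le> l"
    and up: "\<And>x c. x \<in> M \<Longrightarrow> c \<in> subcubes n l \<Longrightarrow> inside x c \<Longrightarrow> c \<in> K"
  shows "card M * card (subcubes n l) \<le> card K * card (subcubes n j)"
proof -
  define N where "N = (n - j) choose (l - j)"
  define D where "D = (l choose j) * 2 ^ (l - j)"
  have "D > 0" using jl by (simp add: D_def)
  have "card M * N = (\<Sum>c\<in>subcubes n l. card {x \<in> M. inside x c})"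
    using sum_card_inside[OF M jl] by (simp add: N_def)
  also have "\<dots> = (\<Sum>c\<in>K. card {x \<in> M. inside x c})"
  proof (rule sum.mono_neutral_right)
    show "\<forall>c\<in>subcubes n l - K. card {x \<in> M. inside x c} = 0"
    proof
      fix c assume "c \<in> subcubes n l - K"
      then have "{x \<in> M. inside x c} = {}" using up by blast
      then show "card {x \<in> M. inside x c} = 0" by (simp only: card.empty)
    qed
  qed (use K in auto)
  also have "\<dots> \<le> (\<Sum>c\<in>K. D)"
  proof (rule sum_mono)
    fix c assume c: "c \<in> K"
    have "card {x \<in> M. inside x c} \<le> card {x \<in> subcubes n j. inside x c}"
      using M by (intro card_mono) auto
    then show "card {x \<in> M. inside x c} \<le> D"
      using card_inside_subcubes[of c n l j] c K by (auto simp: D_def)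
  qed
  finally have "card M * N \<le> card K * D" by simp
  then have "card M * N * card (subcubes n j) \<le> card K * D * card (subcubes n j)"
    by (rule mult_right_mono) simp
  moreover have "card (subcubes n l) * D = card (subcubes n j) * N"
    using card_subcubes_incidence[OF jl, of n] by (simp add: N_def D_def)
  then have "card M * N * card (subcubes n j) = card M * card (subcubes n l) * D"
    by (metis mult.assoc mult.commute)
  ultimately have "(card M * card (subcubes n l)) * D \<le> (card K * card (subcubes n j)) * D"
    by (simp only: ac_simps)
  then show ?thesis unfolding mult_le_cancel2 using \<open>D > 0\<close> by simp
qed

subsection \<open>Upper bounds\<close>

lemma card_killed:
  assumes "M \<subseteq> subcubes n 1"
  shows "real (card (subcubes n l - avoiding n l M)) = card (subcubes n l) - real (card (avoiding n l M))"
proof -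
  have "avoiding n l M \<subseteq> subcubes n l" by (auto simp: avoiding_def)
  then show ?thesis
    by (metis card_Diff_subset card_mono finite_subcubes finite_subset of_nat_diff)
qed

lemma avoiding_upper_local:
  assumes M: "M \<subseteq> subcubes n 1" "avoiding n k M = {}" and l: "1 \<le> l" "l \<le> k" "k \<le> n"
  shows "card (avoiding n l M) \<le> (1 - real l * 2 ^ l / (real k * 2 ^ k)) * card (subcubes n l)"
proof -
  let ?K = "subcubes n l - avoiding n l M"
  have "real ((k - 1) choose (l - 1)) * card (subcubes n l) \<le> card ?K * ((k choose l) * 2 ^ (k - l))"
  proof (rule local_density_le)
    fix c assume c: "c \<in> subcubes n k"
    then obtain x where x: "x \<in> M" "inside x c" using M(2) unfolding avoiding_def by blast
    have "card {y \<in> subcubes n l. inside x y \<and> inside y c} \<le> card {y \<in> ?K. inside y c}"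
      using x by (intro card_mono) (auto simp: avoiding_def)
    then show "real ((k - 1) choose (l - 1)) \<le> card {y \<in> ?K. inside y c}"
      using card_between_subcubes[OF _ c x(2) l(1)] x M(1) by auto
  qed (use l in auto)
  \<comment> \<open>Absorption gives the factor \<open>l / k\<close>; the factor
    \<open>2 ^ l / 2 ^ k\<close> comes from the \<open>2 ^ (k - l)\<close> parallel faces.\<close>
  moreover have "real k * real ((k - 1) choose (l - 1)) = real l * real (k choose l)"
    using times_binomial_minus1_eq[of l k] l by (metis of_nat_mult less_le_trans zero_less_one)
  then have "real ((k - 1) choose (l - 1)) = real l / real k * real (k choose l)"
    using l by (simp add: field_simps)
  ultimately have "real (k choose l) * (real l / real k * card (subcubes n l)) \<le>
      real (k choose l) * (real (card ?K) * 2 ^ (k - l))"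
    by (simp add: ac_simps)
  then have "real l / real k * card (subcubes n l) \<le> real (card ?K) * 2 ^ (k - l)"
    by (rule mult_left_le_imp_le) (use l in simp)
  moreover have "2 ^ (k - l) = (2 ^ k / 2 ^ l :: real)"
    using l by (simp add: power_diff)
  ultimately have "real l / real k * card (subcubes n l) \<le> real (card ?K) * (2 ^ k / 2 ^ l)"
    by (simp only:)
  then have "real l * 2 ^ l / (real k * 2 ^ k) * card (subcubes n l) \<le> card ?K"
    using l by (simp add: field_simps)
  then show ?thesis
    unfolding card_killed[OF M(1)] by (simp add: algebra_simps)
qed

text \<open>Fixing one of two free coordinates to 1 and the other to 0 leaves a \<open>Q\<^sub>k\<close>, whose missing
  edge tells the two coordinates apart. Hence \<open>k + 2 \<le> 2\<^sup>m\<close> for the number \<open>m\<close> of missing edges.\<close>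

lemma missing_edges_separate:
  assumes M: "M \<subseteq> subcubes n 1" "avoiding n k M = {}" and c: "c \<in> subcubes n (k + 2)"
  shows "k + 2 \<le> 2 ^ card {x \<in> M. inside x c}"
proof -
  obtain F B where FB: "c = (F, B)" by fastforce
  have F: "F \<subseteq> {..<n}" "card F = k + 2" "B \<subseteq> {..<n}" "B \<inter> F = {}" "finite F"
    using c FB finite_subset by (auto simp: subcubes_def)
  define Mc where "Mc = {x \<in> M. inside x c}"
  have "finite M" using M(1) finite_subset finite_subcubes by blast
  then have fin: "finite Mc" by (simp add: Mc_def)
  have sep: "\<exists>x\<in>Mc. i \<in> snd x \<and> j \<notin> snd x" if "i \<in> F" "j \<in> F" "i \<noteq> j" for i j
  proof -
    have "(F - {i, j}, insert i B) \<in> subcubes n k"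
      using F that by (auto simp: subcubes_def card_Diff_subset)
    then obtain x where x: "x \<in> M" "inside x (F - {i, j}, insert i B)"
      using M(2) unfolding avoiding_def by blast
    obtain G A where A: "x = (G, A)" by fastforce
    have GA: "G \<subseteq> F - {i, j}" "A - (F - {i, j}) = insert i B"
      using x A by (auto simp: inside_def)
    then have "i \<in> A" by blast
    moreover have "j \<notin> A"
    proof
      assume "j \<in> A"
      then have "j \<in> insert i B" using GA(2) by blast
      then show False using that F(4) by blast
    qed
    moreover have "x \<in> Mc"
    proof -
      have "A - F = (A - (F - {i, j})) - F" by auto
      also have "\<dots> = B" unfolding GA(2) using that(1) F(4) by auto
      finally show ?thesis using x(1) GA(1) A FB by (auto simp: Mc_def inside_def)
    qed
    ultimately show ?thesis using A by force
  qed
  let ?t = "\<lambda>i. {x \<in> Mc. i \<in> snd x}"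
  have "inj_on ?t F"
  proof (rule inj_onI, rule ccontr)
    fix i j assume ij: "i \<in> F" "j \<in> F" "?t i = ?t j" "i \<noteq> j"
    then obtain x where "x \<in> Mc" "i \<in> snd x" "j \<notin> snd x" using sep by blast
    then have "x \<in> ?t i" "x \<notin> ?t j" by simp_all
    then show False using ij(3) by simp
  qed
  then have "card F \<le> card (Pow Mc)"
    by (rule card_inj_on_le) (use fin in blast)+
  then have "k + 2 \<le> 2 ^ card Mc" using F(2) card_Pow[OF fin] by simp
  then show ?thesis by (simp only: Mc_def)
qed

text \<open>Averaging over subcubes of dimension \<open>k + 2\<close> bounds the density of
  \<open>M\<close> from below; \<open>up_closed_density_mono\<close> carries this bound over to the
  spoiled \<open>l\<close>-subcubes.\<close>

lemma avoiding_upper_log: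
  assumes M: "M \<subseteq> subcubes n 1" "avoiding n k M = {}" and l: "1 \<le> l" "l \<le> k" "2 \<le> k" "k + 2 \<le> n"
  shows "card (avoiding n l M) \<le> (1 - 1 / 4 * (ln (real k) / (real k * 2 ^ k))) * card (subcubes n l)"
proof -
  let ?K = "subcubes n l - avoiding n l M"
  have "ln (real k) * card (subcubes n 1) \<le> card M * (((k + 2) choose 1) * 2 ^ (k + 2 - 1))"
  proof (rule local_density_le[OF M(1)])
    fix c assume "c \<in> subcubes n (k + 2)"
    then have "k + 2 \<le> 2 ^ card {x \<in> M. inside x c}" (is "_ \<le> 2 ^ ?m")
      by (rule missing_edges_separate[OF M])
    then have "k \<le> 2 ^ ?m" by simp
    then have "real k \<le> 2 ^ ?m" by (metis of_nat_le_iff of_nat_numeral of_nat_power)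
    then have "ln (real k) \<le> ln (2 ^ ?m)" using l by simp
    also have "\<dots> = ?m * ln 2" by (simp add: ln_realpow)
    also have "\<dots> \<le> real ?m * 1" using ln_2_less_1 by (intro mult_left_mono) auto
    finally show "ln (real k) \<le> ?m" by simp
  qed (use l in auto)
  also have "\<dots> = card M * (2 * (real k + 2) * 2 ^ k)" by (simp add: algebra_simps)
  \<comment> \<open>The constant 1/4 arises here, from \<open>2 * (k + 2) \<le> 4 * k\<close> for
    \<open>k \<ge> 2\<close>.\<close>
  also have "\<dots> \<le> card M * (4 * (real k * 2 ^ k))"
    using l by (intro mult_left_mono) auto
  finally have 1: "ln (real k) / (4 * (real k * 2 ^ k)) * card (subcubes n 1) \<le> card M"
    using l by (simp add: field_simps)
  have "card M * card (subcubes n l) \<le> card ?K * card (subcubes n 1)"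
    by (rule up_closed_density_mono[OF M(1)]) (use l in \<open>auto simp: avoiding_def\<close>)
  then have "real (card M) * card (subcubes n l) \<le> real (card ?K) * card (subcubes n 1)"
    by (metis of_nat_le_iff of_nat_mult)
  moreover have "ln (real k) / (4 * (real k * 2 ^ k)) * card (subcubes n 1) * card (subcubes n l)
      \<le> real (card M) * card (subcubes n l)"
    using 1 by (rule mult_right_mono) simp
  ultimately have "ln (real k) / (4 * (real k * 2 ^ k)) * card (subcubes n l) * card (subcubes n 1)
      \<le> real (card ?K) * card (subcubes n 1)"
    by (simp add: ac_simps)
  moreover have "card (subcubes n 1) > 0" using l by (simp add: card_subcubes)
  ultimately have "ln (real k) / (4 * (real k * 2 ^ k)) * card (subcubes n l) \<le> card ?K"
    by (simp only: mult_le_cancel_right_pos of_nat_0_less_iff)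
  then show ?thesis
    unfolding card_killed[OF M(1)] by (simp add: algebra_simps)
qed

subsection \<open>Lower bounds\<close>

lemma colouring_lower_bound:
  assumes C: "finite C" "C \<noteq> {}" and kl: "1 \<le> k" "1 \<le> l" "l \<le> n"
    and all: "\<And>c. c \<in> subcubes n k \<Longrightarrow> C \<subseteq> col ` {x \<in> subcubes n 1. inside x c}"
    and few: "\<And>c. c \<in> subcubes n l \<Longrightarrow> card (C \<inter> col ` {x \<in> subcubes n 1. inside x c}) \<le> s"
  shows "1 - real s / card C \<le> ex_density (hypercube n) (hypercube l) (hypercube k)"
proof -
  define seen where "seen c = C \<inter> col ` {x \<in> subcubes n 1. inside x c}" for c
  define killed where "killed g = {c \<in> subcubes n l. g \<in> seen c}" for g
  have pos: "card (subcubes n l) > 0" using kl by (simp add: card_subcubes)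
  \<comment> \<open>Summed over \<open>g\<close>, the sizes of \<open>killed g\<close> count pairs
    of an \<open>l\<close>-subcube and a colour it sees, at most \<open>s\<close> per subcube; some
    colour does no worse than the average.\<close>
  have "\<exists>g\<in>C. card C * card (killed g) \<le> s * card (subcubes n l)"
  proof (rule ccontr)
    assume "\<not> ?thesis"
    then have "(\<Sum>g\<in>C. s * card (subcubes n l)) < (\<Sum>g\<in>C. card C * card (killed g))"
      using C by (intro sum_strict_mono) (auto simp: not_le)
    also have "\<dots> = card C * (\<Sum>g\<in>C. card (killed g))" by (simp add: sum_distrib_left)
    also have "(\<Sum>g\<in>C. card (killed g)) = (\<Sum>c\<in>subcubes n l. card (seen c))"
      unfolding killed_def using C
      by (subst sum_multicount_gen[where k = "\<lambda>c. card (seen c)"])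
        (auto simp: seen_def intro!: arg_cong[where f = card])
    also have "\<dots> \<le> (\<Sum>c\<in>subcubes n l. s)"
      using few unfolding seen_def by (intro sum_mono)
    finally show False by (simp add: ac_simps)
  qed
  then obtain g where g: "g \<in> C" "card C * card (killed g) \<le> s * card (subcubes n l)" by blast
  define M where "M = {x \<in> subcubes n 1. col x = g}"
  have M: "M \<subseteq> subcubes n 1" by (auto simp: M_def)
  have "avoiding n k M = {}"
  proof -
    have False if c: "c \<in> subcubes n k" "\<forall>x\<in>M. \<not> inside x c" for c
      using all[OF c(1)] c(2) g(1) by (auto simp: M_def)
    then show ?thesis by (auto simp: avoiding_def)
  qed
  then have "card (avoiding n l M) \<le> ex_num (hypercube n) (hypercube l) (hypercube k)"
    using ex_num_hypercube_ge kl M by blast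
  moreover have "subcubes n l - avoiding n l M = killed g"
    using g(1) by (auto simp: avoiding_def killed_def seen_def M_def)
  then have "real (card (avoiding n l M)) = card (subcubes n l) - real (card (killed g))"
    using card_killed[OF M, of l] by simp
  moreover have "real (card C) * card (killed g) \<le> real s * card (subcubes n l)"
    using g(2) by (metis of_nat_le_iff of_nat_mult)
  then have "real (card (killed g)) \<le> real s / card C * card (subcubes n l)"
    using C by (simp add: field_simps card_gt_0_iff)
  ultimately have "card (subcubes n l) - real s / card C * card (subcubes n l) \<le>
      ex_num (hypercube n) (hypercube l) (hypercube k)"
    by linarith
  then have "(1 - real s / card C) * card (subcubes n l) \<le>
      ex_num (hypercube n) (hypercube l) (hypercube k)"
    by (simp only: left_diff_distrib mult_1)
  then show ?thesis
    using pos unfolding ex_density_def num_copies_hypercube_hypercube[OF kl(2)]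
    by (simp add: pos_le_divide_eq)
qed

section \<open>Colouring by level\<close>

text \<open>Among \<open>k\<close> consecutive integers every residue occurs. The witness is
  \<open>r - m\<close> modulo \<open>k\<close>, arranged so that natural subtraction does not
  truncate.\<close>

lemma ex_shift_mod_eq:
  fixes r k m :: nat
  assumes "r < k"
  shows "\<exists>t<k. (m + t) mod k = r"
proof (intro exI conjI)
  let ?t = "(r + (k - m mod k)) mod k"
  have "m mod k < k" using assms by simp
  then have "m mod k + (r + (k - m mod k)) = r + k" by linarith
  then have "(m mod k + (r + (k - m mod k))) mod k = r" using assms by simp
  then show "(m + ?t) mod k = r" by (metis mod_add_left_eq mod_add_right_eq)
  show "?t < k" using assms by simp
qed

lemma level_colouring_bound:
  assumes "1 \<le> l" "l < k" "k \<le> n"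
  shows "1 - real l / real k \<le> ex_density (hypercube n) (hypercube l) (hypercube k)"
proof -
  define col :: "subcube \<Rightarrow> nat" where "col x = card (snd x) mod k" for x
  have "1 - real l / card {..<k} \<le> ex_density (hypercube n) (hypercube l) (hypercube k)"
  proof (rule colouring_lower_bound[where col = col])
    fix c assume c: "c \<in> subcubes n k"
    obtain F B where FB: "c = (F, B)" by fastforce
    have F: "F \<subseteq> {..<n}" "card F = k" "B \<subseteq> {..<n}" "B \<inter> F = {}" "finite F" "finite B"
      using c FB finite_subset by (auto simp: subcubes_def)
    show "{..<k} \<subseteq> col ` {x \<in> subcubes n 1. inside x c}"
    proof
      fix r assume r: "r \<in> {..<k}"
      obtain t where t: "t < k" "(card B + t) mod k = r"
        using ex_shift_mod_eq[of r k "card B"] r by auto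
      obtain X where X: "X \<subseteq> F" "card X = t" "finite X"
        using obtain_subset_with_card_n[of t F] F t(1) by auto
      \<comment> \<open>Since \<open>t < k\<close>, a free coordinate remains to be flipped by the
        edge.\<close>
      then have "X \<noteq> F" using F t by auto
      then obtain i where i: "i \<in> F" "i \<notin> X" using X by auto
      let ?x = "({i}, B \<union> X)"
      have "?x \<in> subcubes n 1" "inside ?x c"
        using F X i FB by (auto simp: subcubes_def inside_def)
      moreover have "card (B \<union> X) = card B + t"
        using F X by (subst card_Un_disjoint) auto
      then have "col ?x = r" using t by (simp add: col_def)
      ultimately show "r \<in> col ` {x \<in> subcubes n 1. inside x c}" by force
    qed
  next
    fix c assume c: "c \<in> subcubes n l"
    obtain F B where FB: "c = (F, B)" by fastforce
    have F: "F \<subseteq> {..<n}" "card F = l" "B \<inter> F = {}" "finite F" "finite B"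
      using c FB finite_subset by (auto simp: subcubes_def)
    have "{..<k} \<inter> col ` {x \<in> subcubes n 1. inside x c} \<subseteq> (\<lambda>t. (card B + t) mod k) ` {..<l}"
    proof clarify
      fix G A assume x: "(G, A) \<in> subcubes n 1" "inside (G, A) c"
      have A: "G \<subseteq> F" "A = B \<union> (A \<inter> F)" "G \<inter> A = {}" "G \<noteq> {}"
        using x FB by (auto simp: subcubes_def inside_def)
      have "card A = card B + card (A \<inter> F)"
        using F by (subst A(2), subst card_Un_disjoint) auto
      \<comment> \<open>The flipped coordinate is not in \<open>A\<close>, so only \<open>l\<close>
        levels occur, not \<open>l + 1\<close>.\<close>
      moreover have "card (A \<inter> F) < card F"
        using A F by (intro psubset_card_mono) auto
      ultimately show "col (G, A) \<in> (\<lambda>t. (card B + t) mod k) ` {..<l}"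
        using F by (auto simp: col_def)
    qed
    then have "card ({..<k} \<inter> col ` {x \<in> subcubes n 1. inside x c}) \<le>
        card ((\<lambda>t. (card B + t) mod k) ` {..<l})"
      by (intro card_mono) auto
    also have "\<dots> \<le> l" using card_image_le[of "{..<l}"] by simp
    finally show "card ({..<k} \<inter> col ` {x \<in> subcubes n 1. inside x c}) \<le> l" .
  qed (use assms in auto)
  then show ?thesis by simp
qed

section \<open>Colouring by two residues\<close>

text \<open>Ranks serve to pick a free coordinate with prescribed numbers of free coordinates on
  both sides, and to reindex a sum over free coordinates.\<close>

lemma rank_bij_betw:
  fixes F :: "nat set"
  assumes "finite F"
  shows "bij_betw (\<lambda>i. card (F \<inter> {..<i})) F {..<card F}"
proof -
  let ?r = "\<lambda>i. card (F \<inter> {..<i})"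
  have mono: "?r i < ?r j" if "i \<in> F" "i < j" for i j
    using assms that by (intro psubset_card_mono) auto
  have inj: "inj_on ?r F"
  proof (rule inj_onI)
    fix i j assume "i \<in> F" "j \<in> F" "?r i = ?r j"
    then show "i = j" using mono[of i j] mono[of j i] by (cases i j rule: linorder_cases) auto
  qed
  have "?r i < card F" if "i \<in> F" for i
    using assms that by (intro psubset_card_mono) auto
  then have "?r ` F \<subseteq> {..<card F}" by auto
  moreover have "card (?r ` F) = card {..<card F}" using inj by (simp add: card_image)
  ultimately have "?r ` F = {..<card F}" by (intro card_subset_eq) auto
  then show ?thesis using inj by (simp add: bij_betw_def)
qed

lemma card_split_at:
  fixes F :: "nat set"
  assumes "finite F" "i \<in> F"
  shows "card F = Suc (card (F \<inter> {..<i}) + card (F \<inter> {i<..}))"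
proof -
  have "F = insert i ((F \<inter> {..<i}) \<union> (F \<inter> {i<..}))" using assms(2) by auto
  then have "card F = card (insert i ((F \<inter> {..<i}) \<union> (F \<inter> {i<..})))" by simp
  also have "\<dots> = Suc (card ((F \<inter> {..<i}) \<union> (F \<inter> {i<..})))"
    using assms(1) by (intro card_insert_disjoint) auto
  also have "card ((F \<inter> {..<i}) \<union> (F \<inter> {i<..})) = card (F \<inter> {..<i}) + card (F \<inter> {i<..})"
    using assms(1) by (intro card_Un_disjoint) auto
  finally show ?thesis .
qed

lemma sum_Suc_eq_choose: "(\<Sum>p<l. Suc p) = Suc l choose 2"
  by (induction l) (auto simp: numeral_2_eq_2)

text \<open>Each triple among \<open>l + 2\<close> points is counted by its middle element, with
  \<open>Suc p\<close> choices on its left and \<open>l - p\<close> on its right. The induction uses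
  Pascal's rule instead.\<close>

lemma sum_rank_products: "(\<Sum>p<l. Suc p * (l - p)) = (l + 2) choose 3"
proof (induction l)
  case (Suc l)
  have "(\<Sum>p<Suc l. Suc p * (Suc l - p)) = (\<Sum>p<Suc l. Suc p * (l - p) + Suc p)"
    by (intro sum.cong) (auto simp: Suc_diff_le algebra_simps)
  \<comment> \<open>The product for \<open>p = l\<close> vanishes.\<close>
  also have "\<dots> = (\<Sum>p<l. Suc p * (l - p)) + (\<Sum>p<Suc l. Suc p)"
    by (simp only: sum.distrib) simp
  also have "\<dots> = (l + 2 choose 3) + (l + 2 choose 2)"
    unfolding Suc.IH sum_Suc_eq_choose by simp
  also have "\<dots> = (Suc l + 2) choose 3"
    by (simp add: numeral_3_eq_3 numeral_2_eq_2)
  finally show ?case .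
qed (simp add: binomial_eq_0)

text \<open>The colour records, modulo \<open>a\<close> and \<open>b\<close>, the numbers of ones to the left and to the right of
  the flipped coordinate. In a \<open>Q\<^sub>k\<close> with \<open>k + 1 = a + b\<close>, the edges flipping the \<open>a\<close>-th free
  coordinate already attain all colours.\<close>

definition residue_colour :: "nat \<Rightarrow> nat \<Rightarrow> subcube \<Rightarrow> nat \<times> nat" where
  "residue_colour a b x =
     (card {j \<in> snd x. \<forall>i\<in>fst x. j < i} mod a, card {j \<in> snd x. \<forall>i\<in>fst x. i < j} mod b)"

lemma residue_colour_edge:
  "residue_colour a b ({i}, A) = (card (A \<inter> {..<i}) mod a, card (A \<inter> {i<..}) mod b)"
proof -
  have "{j \<in> A. j < i} = A \<inter> {..<i}" "{j \<in> A. i < j} = A \<inter> {i<..}" by auto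
  then show ?thesis by (simp add: residue_colour_def)
qed

lemma residue_colour_all:
  assumes c: "c \<in> subcubes n k" and ab: "1 \<le> a" "1 \<le> b" "a + b = k + 1"
  shows "{..<a} \<times> {..<b} \<subseteq> residue_colour a b ` {x \<in> subcubes n 1. inside x c}"
proof clarify
  fix p q assume pq: "p < a" "q < b"
  obtain F B where FB: "c = (F, B)" by fastforce
  have F: "F \<subseteq> {..<n}" "card F = k" "B \<subseteq> {..<n}" "B \<inter> F = {}" "finite F" "finite B"
    using c FB finite_subset by (auto simp: subcubes_def)
  \<comment> \<open>With \<open>a - 1\<close> free coordinates on the left and therefore
    \<open>b - 1\<close> on the right, the two numbers of ones range independently over
    \<open>a\<close> and \<open>b\<close> consecutive values.\<close>
  have "a - 1 \<in> (\<lambda>i. card (F \<inter> {..<i})) ` F"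
    using rank_bij_betw[OF F(5)] ab F(2) by (auto simp: bij_betw_def)
  then obtain i where i: "i \<in> F" "card (F \<inter> {..<i}) = a - 1" by auto
  have i': "card (F \<inter> {i<..}) = b - 1"
    using card_split_at[OF F(5) i(1)] i(2) F(2) ab by simp
  obtain t where t: "t < a" "(card (B \<inter> {..<i}) + t) mod a = p"
    using ex_shift_mod_eq[OF pq(1)] by blast
  obtain u where u: "u < b" "(card (B \<inter> {i<..}) + u) mod b = q"
    using ex_shift_mod_eq[OF pq(2)] by blast
  obtain X where X: "X \<subseteq> F \<inter> {..<i}" "card X = t" "finite X"
    using obtain_subset_with_card_n[of t "F \<inter> {..<i}"] i(2) t(1) by (metis Suc_pred' less_Suc_eq_le One_nat_def Suc_le_eq ab(1))
  obtain Y where Y: "Y \<subseteq> F \<inter> {i<..}" "card Y = u" "finite Y"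
    using obtain_subset_with_card_n[of u "F \<inter> {i<..}"] i' u(1) by (metis Suc_pred' less_Suc_eq_le One_nat_def Suc_le_eq ab(2))
  let ?A = "B \<union> X \<union> Y"
  have "?A \<inter> {..<i} = (B \<inter> {..<i}) \<union> X" "?A \<inter> {i<..} = (B \<inter> {i<..}) \<union> Y"
    using X(1) Y(1) by auto
  moreover have "card ((B \<inter> {..<i}) \<union> X) = card (B \<inter> {..<i}) + t"
    "card ((B \<inter> {i<..}) \<union> Y) = card (B \<inter> {i<..}) + u"
    unfolding X(2)[symmetric] Y(2)[symmetric] using X Y F by (intro card_Un_disjoint; auto)+
  ultimately have "residue_colour a b ({i}, ?A) = (p, q)"
    using t(2) u(2) by (simp add: residue_colour_edge)
  moreover have "({i}, ?A) \<in> subcubes n 1"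
    using F X(1) Y(1) i(1) by (auto simp: subcubes_def)
  moreover have "inside ({i}, ?A) c"
    using F(4) X(1) Y(1) i(1) FB by (auto simp: inside_def)
  ultimately show "(p, q) \<in> residue_colour a b ` {x \<in> subcubes n 1. inside x c}"
    by (metis (mono_tags, lifting) image_eqI mem_Collect_eq)
qed

text \<open>If the flipped coordinate has rank \<open>p\<close> in \<open>F\<close>, the free ones
  on its left number 0 to \<open>p\<close> and those on its right 0 to \<open>l - 1 - p\<close>.
  This gives at most \<open>Suc p * (l - p)\<close> colours, whatever the moduli; \<open>T i\<close>
  contains them.\<close>

lemma residue_colour_few:
  assumes c: "c \<in> subcubes n l"
  shows "card (residue_colour a b ` {x \<in> subcubes n 1. inside x c}) \<le> (l + 2) choose 3"
proof -
  obtain F B where FB: "c = (F, B)" by fastforce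
  have F: "card F = l" "B \<inter> F = {}" "finite F" "finite B"
    using c FB finite_subset by (auto simp: subcubes_def)
  define r where "r i = card (F \<inter> {..<i})" for i
  define T where "T i = (\<lambda>(t, u). ((card (B \<inter> {..<i}) + t) mod a, (card (B \<inter> {i<..}) + u) mod b)) `
    ({..r i} \<times> {..<l - r i})" for i
  have "residue_colour a b ` {x \<in> subcubes n 1. inside x c} \<subseteq> (\<Union>i\<in>F. T i)"
  proof (rule image_subsetI)
    fix x assume "x \<in> {x \<in> subcubes n 1. inside x c}"
    then obtain G A where GA: "x = (G, A)" and x: "(G, A) \<in> subcubes n 1" "inside (G, A) c"
      by (cases x) auto
    then obtain i where G: "G = {i}" by (auto simp: subcubes_def card_1_singleton_iff)
    have i: "i \<in> F" "A - F = B"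
      using x G FB by (auto simp: inside_def)
    have split: "A \<inter> {..<i} = (B \<inter> {..<i}) \<union> (A \<inter> F \<inter> {..<i})"
      "A \<inter> {i<..} = (B \<inter> {i<..}) \<union> (A \<inter> F \<inter> {i<..})"
      using i(2) by auto
    have cards: "card (A \<inter> {..<i}) = card (B \<inter> {..<i}) + card (A \<inter> F \<inter> {..<i})"
      "card (A \<inter> {i<..}) = card (B \<inter> {i<..}) + card (A \<inter> F \<inter> {i<..})"
      by (subst split, subst card_Un_disjoint; use F in auto)+
    have "card (A \<inter> F \<inter> {..<i}) \<le> r i"
      unfolding r_def using F(3) by (intro card_mono) auto
    moreover have "card (A \<inter> F \<inter> {i<..}) \<le> card (F \<inter> {i<..})"
      using F(3) by (intro card_mono) auto
    then have "card (A \<inter> F \<inter> {i<..}) < l - r i"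
      using card_split_at[OF F(3) i(1)] F(1) unfolding r_def by linarith
    ultimately have "(card (A \<inter> F \<inter> {..<i}), card (A \<inter> F \<inter> {i<..})) \<in> {..r i} \<times> {..<l - r i}"
      by simp
    then have "residue_colour a b (G, A) \<in> T i"
      unfolding T_def G residue_colour_edge cards by (rule rev_image_eqI) simp
    then show "residue_colour a b x \<in> (\<Union>i\<in>F. T i)" using i(1) GA by blast
  qed
  then have "card (residue_colour a b ` {x \<in> subcubes n 1. inside x c}) \<le> card (\<Union>i\<in>F. T i)"
    by (rule card_mono[rotated]) (simp add: F(3) T_def)
  also have "\<dots> \<le> (\<Sum>i\<in>F. card (T i))"
    by (rule card_UN_le[OF F(3)])
  also have "\<dots> \<le> (\<Sum>i\<in>F. Suc (r i) * (l - r i))"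
  proof (rule sum_mono)
    fix i
    have "card (T i) \<le> card ({..r i} \<times> {..<l - r i})"
      unfolding T_def by (rule card_image_le) simp
    then show "card (T i) \<le> Suc (r i) * (l - r i)" by simp
  qed
  also have "\<dots> = (\<Sum>p<l. Suc p * (l - p))"
    using rank_bij_betw[OF F(3)] unfolding F(1) r_def
    by (rule sum.reindex_bij_betw)
  also have "\<dots> = (l + 2) choose 3" by (rule sum_rank_products)
  finally show ?thesis .
qed

lemma residue_colouring_bound:
  assumes "1 \<le> l" "l < k" "k \<le> n"
  shows "1 - 4 * real ((l + 2) choose 3) / (real k * (real k + 2))
    \<le> ex_density (hypercube n) (hypercube l) (hypercube k)"
proof -
  \<comment> \<open>A balanced split maximizes the number \<open>a * b\<close> of colours. It equals
    \<open>k * (k + 2) / 4\<close> for even \<open>k\<close> and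
    \<open>(k + 1) * (k + 1) / 4\<close> for odd \<open>k\<close>.\<close>
  define a where "a = (k + 1) div 2"
  define b where "b = k + 1 - a"
  have ab: "1 \<le> a" "1 \<le> b" "a + b = k + 1"
    using assms by (auto simp: a_def b_def)
  have "a = b \<or> b = Suc a" unfolding b_def a_def by presburger
  then have "k * (k + 2) \<le> 4 * (a * b)"
  proof
    assume "a = b"
    then have "k + 1 = 2 * a" using ab by simp
    then have "(k + 1) * (k + 1) = 4 * (a * b)" using \<open>a = b\<close> by simp
    then show ?thesis by simp
  next
    assume "b = Suc a"
    then have "k = 2 * a" using ab by simp
    then show ?thesis using \<open>b = Suc a\<close> by simp
  qed
  then have kk: "real k * (real k + 2) \<le> 4 * (real a * real b)"
    by (metis of_nat_add of_nat_le_iff of_nat_mult of_nat_numeral)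
  let ?s = "(l + 2) choose 3"
  have "4 * real ?s / (4 * (real a * real b)) \<le> 4 * real ?s / (real k * (real k + 2))"
    using kk assms ab by (intro divide_left_mono) auto
  then have "1 - 4 * real ?s / (real k * (real k + 2)) \<le> 1 - real ?s / card ({..<a} \<times> {..<b})"
    by simp
  also have "\<dots> \<le> ex_density (hypercube n) (hypercube l) (hypercube k)"
  proof (rule colouring_lower_bound[where col = "residue_colour a b"])
    show "{..<a} \<times> {..<b} \<noteq> {}" using ab by (auto simp: lessThan_empty_iff)
    fix c assume "c \<in> subcubes n l"
    then have "card (residue_colour a b ` {x \<in> subcubes n 1. inside x c}) \<le> ?s"
      by (rule residue_colour_few)
    moreover have "card ({..<a} \<times> {..<b} \<inter> residue_colour a b ` {x \<in> subcubes n 1. inside x c})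
        \<le> card (residue_colour a b ` {x \<in> subcubes n 1. inside x c})"
      by (intro card_mono) auto
    ultimately show "card ({..<a} \<times> {..<b} \<inter> residue_colour a b ` {x \<in> subcubes n 1. inside x c}) \<le> ?s"
      by (rule order_trans[rotated])
  qed (use assms ab residue_colour_all in auto)
  finally show ?thesis .
qed

section \<open>Assembling the bounds\<close>

text \<open>The bound \<open>t\<close> is quantified inside, so that a single extremal
  \<open>M\<close> serves both upper bounds.\<close>

lemma ex_density_hypercube_attained:
  assumes "1 \<le> k" "1 \<le> l" "l \<le> n"
  obtains M where "M \<subseteq> subcubes n 1" "avoiding n k M = {}"
    "\<And>t :: real. real (card (avoiding n l M)) \<le> t * card (subcubes n l) \<Longrightarrow>
      ex_density (hypercube n) (hypercube l) (hypercube k) \<le> t"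
proof -
  obtain M where M: "M \<subseteq> subcubes n 1" "avoiding n k M = {}"
    "ex_num (hypercube n) (hypercube l) (hypercube k) = card (avoiding n l M)"
    using ex_num_hypercube_attained[OF assms(1,2)] .
  have "card (subcubes n l) > 0" using assms(3) by (simp add: card_subcubes)
  then show thesis
    using that[OF M(1,2)] M(3)
    by (simp add: ex_density_def num_copies_hypercube_hypercube[OF assms(2)] pos_divide_le_eq)
qed

theorem theorem1:
  shows "\<exists>\<alpha>::real. \<alpha> > 0 \<and>
    (\<forall>k l :: nat. 2 \<le> l \<and> l < k \<longrightarrow>
      (\<exists>n0::nat. \<forall>n\<ge>n0.
        max (1 - real l / real k)
            (1 - 4 * real ((l + 2) choose 3) / (real k * (real k + 2)))
          \<le> ex_density (hypercube n) (hypercube l) (hypercube k) \<and>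
        ex_density (hypercube n) (hypercube l) (hypercube k)
          \<le> min (1 - real l * 2 ^ l / (real k * 2 ^ k))
                (1 - \<alpha> * (ln (real k) / (real k * 2 ^ k)))))"
proof (rule exI[of _ "1 / 4"], intro conjI allI impI)
  fix k l :: nat
  assume "2 \<le> l \<and> l < k"
  then have kl: "2 \<le> l" "l < k" by auto
  show "\<exists>n0. \<forall>n\<ge>n0.
        max (1 - real l / real k)
            (1 - 4 * real ((l + 2) choose 3) / (real k * (real k + 2)))
          \<le> ex_density (hypercube n) (hypercube l) (hypercube k) \<and>
        ex_density (hypercube n) (hypercube l) (hypercube k)
          \<le> min (1 - real l * 2 ^ l / (real k * 2 ^ k))
                (1 - 1 / 4 * (ln (real k) / (real k * 2 ^ k)))"
  \<comment> \<open>The logarithmic bound averages over subcubes of dimension \<open>k + 2\<close>,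
    which must exist; the other bounds need only \<open>k \<le> n\<close>.\<close>
  proof (intro exI[of _ "k + 2"] allI impI conjI)
    fix n assume n: "k + 2 \<le> n"
    show "max (1 - real l / real k) (1 - 4 * real ((l + 2) choose 3) / (real k * (real k + 2)))
        \<le> ex_density (hypercube n) (hypercube l) (hypercube k)"
      using level_colouring_bound[of l k n] residue_colouring_bound[of l k n] kl n
      by (intro max.boundedI) auto
    obtain M where M: "M \<subseteq> subcubes n 1" "avoiding n k M = {}"
      and dens: "\<And>t :: real. real (card (avoiding n l M)) \<le> t * card (subcubes n l) \<Longrightarrow>
        ex_density (hypercube n) (hypercube l) (hypercube k) \<le> t"
      by (rule ex_density_hypercube_attained[of k l n]) (use kl n in auto)
    show "ex_density (hypercube n) (hypercube l) (hypercube k)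
        \<le> min (1 - real l * 2 ^ l / (real k * 2 ^ k))
              (1 - 1 / 4 * (ln (real k) / (real k * 2 ^ k)))"
    proof (rule min.boundedI)
      show "ex_density (hypercube n) (hypercube l) (hypercube k)
          \<le> 1 - real l * 2 ^ l / (real k * 2 ^ k)"
        by (rule dens[OF avoiding_upper_local[OF M]]) (use kl n in auto)
      show "ex_density (hypercube n) (hypercube l) (hypercube k)
          \<le> 1 - 1 / 4 * (ln (real k) / (real k * 2 ^ k))"
        by (rule dens[OF avoiding_upper_log[OF M]]) (use kl n in auto)
    qed
  qed
qed simp

end
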